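(* Let $M\ge 1$ be an integer, let $G$ be an $n$-vertex $d$-regular $\lambda$-expander and let $v_0\in V(G)$. For every $f\in \mathrm{Lip}_{v_0}(G;M)$ there exists $k\in\mathbb{Z}$ such that $$\left|\{v\in V(G) : f(v)\notin\{k,k+1,\ldots,k+M\}\}\right| \le \frac{2\lambda n}{d}. \qquad ( * )$$ Moreover, one can associate to each $f\in \mathrm{Lip}_{v_0}(G;M)$ which is not identically zero an interval $\mathrm{phase}(f)$ of the form $\{k,k+1,\ldots,k+M\}$ with $k \in \mathbb{Z}$ satisfying $( * )$, in such a manner that $\mathrm{phase}(-f)=-\mathrm{phase}(f)$ for every such $f$ (where $-I=\{-a : a\in I\}$).
   Context: Graphs are finite, simple and undirected; $d\ge 1$ is an integer and $\lambda$ is a real number. For a graph $G$, a vertex $v_0\in V(G)$ and a positive integer $M$, $\mathrm{Lip}_{v_0}(G;M)$ is the set of all $f: V(G)\to\mathbb{Z}$ with $f(v_0)=0$ and $|f(u)-f(v)|\le M$ for every edge $\{u,v\}\in E(G)$. For $S,T\subseteq V(G)$, $e(S,T)$ is the number of pairs $(a,b)\in S\times T$ such that $\{a,b\}\in E(G)$. A $d$-regular $n$-vertex graph $G$ is a $\lambda$-expander if for all $S,T\subseteq V(G)$, $\left|e(S,T)-\frac{d}{n}|S||T|\right|\le\lambda\sqrt{|S||T|}$. *)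

theory Defs
  imports
    Complex_Main
    "HOL-Library.FuncSet"
    "Graph_Theory.Digraph"
begin

text \<open>
  A finite simple undirected graph is a \<^locale>\<open>graph\<close>, that is, a finite symmetric digraph
  without loops and multiple arcs: an edge is a pair of opposite arcs, so \<^const>\<open>out_degree\<close> is
  the degree, and \<^term>\<open>u \<rightarrow>\<^bsub>G\<^esub> v\<close> is adjacency.
\<close>

definition d_regular :: "('a, 'b) pre_digraph \<Rightarrow> nat \<Rightarrow> bool" where
  "d_regular G d \<longleftrightarrow> (\<forall>v\<in>verts G. out_degree G v = d)"

text \<open>\<open>S\<close> and \<open>T\<close> may overlap; an edge inside their intersection is counted twice.\<close>

definition edge_count :: "('a, 'b) pre_digraph \<Rightarrow> 'a set \<Rightarrow> 'a set \<Rightarrow> nat" where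
  "edge_count G S T = card {(a, b). a \<in> S \<and> b \<in> T \<and> a \<rightarrow>\<^bsub>G\<^esub> b}"

definition regular_expander :: "('a, 'b) pre_digraph \<Rightarrow> nat \<Rightarrow> nat \<Rightarrow> real \<Rightarrow> bool" where
  "regular_expander G n d lam \<longleftrightarrow>
     graph G \<and> card (verts G) = n \<and> d_regular G d \<and>
     (\<forall>S T. S \<subseteq> verts G \<longrightarrow> T \<subseteq> verts G \<longrightarrow>
        \<bar>real (edge_count G S T) - real d / real n * real (card S) * real (card T)\<bar>
          \<le> lam * sqrt (real (card S) * real (card T)))"

text \<open>
  Functions on the vertex set are extensional (\<^const>\<open>undefined\<close> off \<^term>\<open>verts G\<close>), so that
  equality of elements of \<open>Lip\<close> is equality as functions on the vertex set.
\<close>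

definition Lip :: "('a, 'b) pre_digraph \<Rightarrow> 'a \<Rightarrow> nat \<Rightarrow> ('a \<Rightarrow> int) set" where
  "Lip G v0 M = {f \<in> verts G \<rightarrow>\<^sub>E UNIV.
     f v0 = 0 \<and> (\<forall>u v. u \<rightarrow>\<^bsub>G\<^esub> v \<longrightarrow> \<bar>f u - f v\<bar> \<le> int M)}"

end

theory Submission
  imports Defs
begin

text \<open>
  Let \<open>t = \<lambda>n/d\<close>. Two vertex sets with no edge between them have sizes whose geometric mean is at
  most \<open>t\<close>, because the expander inequality then bounds the expected number of edges by the error
  term (lemma \<open>expander_no_edges\<close>). If \<open>f\<close> is \<open>M\<close>-Lipschitz, no edge joins a vertex with
  \<open>f < k + 1\<close> to one with \<open>f > k + M\<close>. Now let \<open>k\<close> be the last level for which at most \<open>t\<close> vertices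
  satisfy \<open>f < k\<close>; it exists unless \<open>t \<ge> n\<close>, when every interval will do. More than \<open>t\<close>
  vertices satisfy \<open>f < k + 1\<close>, so at most \<open>t\<close> satisfy \<open>f > k + M\<close>, and at most \<open>2t\<close> vertices
  have values outside \<open>{k..k + M}\<close> (lemma \<open>Lipschitz_concentrated\<close>).

  Such an interval for \<open>f\<close> yields one for \<open>- f\<close> by reflection. To make the choice odd, it suffices
  to choose freely for one function out of each pair \<open>f\<close>, \<open>- f\<close> and to reflect for the other. The
  two functions are distinct when \<open>f\<close> is nonzero; they have the same support, so the sign at a
  vertex chosen from the support tells them apart.
\<close>

lemma regular_expander_fin_digraph:
  assumes "regular_expander G n d lam"
  shows "fin_digraph G"
proof -
  interpret graph G
    using assms by (simp add: regular_expander_def)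
  show ?thesis by unfold_locales
qed

text \<open>
  With \<open>x\<close> the geometric mean of the two sizes, the expander inequality for a count of zero reads
  \<open>(d/n) x\<^sup>2 \<le> \<lambda> x\<close>. Cancelling \<open>x\<close> gives the bound; when \<open>x = 0\<close> it only says that \<open>\<lambda>n\<close>
  is nonnegative.
\<close>

lemma expander_no_edges:
  assumes expander: "regular_expander G n d lam"
    and "d \<ge> 1" "S \<subseteq> verts G" "T \<subseteq> verts G"
    and no_edge: "\<And>a b. a \<in> S \<Longrightarrow> b \<in> T \<Longrightarrow> \<not> a \<rightarrow>\<^bsub>G\<^esub> b"
  shows "sqrt (real (card S) * real (card T)) \<le> lam * real n / real d"
proof -
  define x where "x = sqrt (real (card S) * real (card T))"
  have discrepancy: "\<bar>real (edge_count G A B) - real d / real n * real (card A) * real (card B)\<bar>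
      \<le> lam * sqrt (real (card A) * real (card B))" if "A \<subseteq> verts G" "B \<subseteq> verts G" for A B
    using expander that by (simp add: regular_expander_def)
  have "card (verts G) = n"
    using expander by (simp add: regular_expander_def)
  \<comment> \<open>The whole vertex set witnesses that \<open>\<lambda>n\<close> is nonnegative.\<close>
  then have nonneg: "0 \<le> lam * real n"
    using order_trans[OF abs_ge_zero discrepancy[of "verts G" "verts G"]] by simp
  have "{(a, b). a \<in> S \<and> b \<in> T \<and> a \<rightarrow>\<^bsub>G\<^esub> b} = {}"
    using no_edge by auto
  then have "edge_count G S T = 0"
    unfolding edge_count_def by (simp only: card.empty)
  then have "real d / real n * (real (card S) * real (card T)) \<le> lam * x"
    using discrepancy[OF assms(3,4)] by (simp add: x_def mult.assoc)
  then have le: "real d / real n * (x * x) \<le> lam * x"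
    by (simp add: x_def)
  have "x \<le> lam * real n / real d"
  proof (cases "x = 0")
    case True
    then show ?thesis using nonneg by simp
  next
    case False
    moreover have "x \<ge> 0" by (simp add: x_def)
    ultimately have "x > 0" by linarith
    have "finite (verts G)"
      using regular_expander_fin_digraph[OF expander] by (rule fin_digraph.finite_verts)
    moreover have "S \<noteq> {}"
      using False by (auto simp: x_def)
    ultimately have "n > 0"
      using \<open>card (verts G) = n\<close> \<open>S \<subseteq> verts G\<close> by (auto simp: card_gt_0_iff)
    have "real d / real n * x \<le> lam"
      using le \<open>x > 0\<close> mult_le_cancel_right_pos[of x "real d / real n * x" lam]
      by (simp only: mult.assoc)
    then show ?thesis
      using \<open>n > 0\<close> \<open>d \<ge> 1\<close> by (simp add: field_simps)
  qed
  then show ?thesis by (simp add: x_def)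
qed

text \<open>
  The vertices below the interval and those above it each contribute half of the bound: the former
  by the choice of \<open>k\<close>, the latter because raising \<open>k\<close> by one makes the lower set large while it
  still has no edge to the upper set.
\<close>

lemma Lipschitz_concentrated:
  fixes f :: "'a \<Rightarrow> int"
  assumes expander: "regular_expander G n d lam" and "d \<ge> 1"
    and Lipschitz: "\<And>u v. u \<rightarrow>\<^bsub>G\<^esub> v \<Longrightarrow> \<bar>f u - f v\<bar> \<le> int M"
  shows "\<exists>k. real (card {v \<in> verts G. f v \<notin> {k..k + int M}}) \<le> 2 * lam * real n / real d"
proof -
  define t where "t = lam * real n / real d"
  define A where "A k = {v \<in> verts G. f v < k}" for k
  have [simp]: "finite (verts G)"
    using regular_expander_fin_digraph[OF expander] by (rule fin_digraph.finite_verts)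
  have "t \<ge> 0"
    using expander_no_edges[OF expander \<open>d \<ge> 1\<close>, of "{}" "{}"] by (simp add: t_def)
  have "\<exists>k. real (card {v \<in> verts G. f v \<notin> {k..k + int M}}) \<le> 2 * t"
  proof (cases "real n \<le> t")
    case True
    have "card {v \<in> verts G. f v \<notin> {0..0 + int M}} \<le> n"
      using expander card_mono[of "verts G"] by (auto simp: regular_expander_def)
    then show ?thesis
      using True \<open>t \<ge> 0\<close> by (intro exI[of _ 0]) linarith
  next
    case False
    obtain l u where bounds: "\<And>v. v \<in> verts G \<Longrightarrow> l \<le> f v \<and> f v < u"
    proof
      show "Min (f ` verts G) \<le> f v \<and> f v < Max (f ` verts G) + 1" if "v \<in> verts G" for v
        using that Min_le[of "f ` verts G" "f v"] Max_ge[of "f ` verts G" "f v"] by simp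
    qed
    have "A (l + int 0) = {}"
      using bounds by (force simp: A_def)
    then have "\<not> real (card (A (l + int 0))) > t"
      using \<open>t \<ge> 0\<close> by simp
    moreover have "A (l + int (nat (u - l))) = verts G"
      using bounds by (force simp: A_def)
    then have "real (card (A (l + int (nat (u - l))))) > t"
      using False expander by (simp add: regular_expander_def)
    \<comment> \<open>Counting levels from the lower bound \<open>l\<close> makes the critical level a natural number.\<close>
    ultimately obtain m where m: "real (card (A (l + int m))) \<le> t" "real (card (A (l + int (Suc m)))) > t"
      using ex_least_nat_less[of "\<lambda>m. real (card (A (l + int m))) > t" "nat (u - l)"]
      by (auto simp: not_less)
    define k where "k = l + int m"
    define B where "B = {v \<in> verts G. f v > k + int M}"
    have small: "real (card (A k)) \<le> t" and large: "real (card (A (k + 1))) > t"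
      using m by (simp_all add: k_def algebra_simps)
    have "\<not> a \<rightarrow>\<^bsub>G\<^esub> b" if "a \<in> A (k + 1)" "b \<in> B" for a b
      using Lipschitz[of a b] that by (auto simp: A_def B_def)
    then have "sqrt (real (card (A (k + 1))) * real (card B)) \<le> t"
      unfolding t_def by (intro expander_no_edges[OF expander \<open>d \<ge> 1\<close>]) (auto simp: A_def B_def)
    then have product: "real (card (A (k + 1))) * real (card B) \<le> t * t"
      by (metis power2_eq_square sqrt_le_D)
    have "real (card B) \<le> t"
    proof (rule ccontr)
      assume "\<not> real (card B) \<le> t"
      then have "t * t < real (card (A (k + 1))) * real (card B)"
        using large \<open>t \<ge> 0\<close> by (intro mult_strict_mono') auto
      then show False using product by simp
    qed
    moreover have "{v \<in> verts G. f v \<notin> {k..k + int M}} = A k \<union> B"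
      by (auto simp: A_def B_def)
    then have "card {v \<in> verts G. f v \<notin> {k..k + int M}} \<le> card (A k) + card B"
      using card_Un_le[of "A k" B] by simp
    ultimately show ?thesis
      using small by (intro exI[of _ k]) linarith
  qed
  then show ?thesis by (simp add: t_def mult.assoc)
qed

theorem lemma1p1:
  fixes G :: "('a, 'b) pre_digraph"
    and n d M :: nat
    and lam :: real
    and v0 :: 'a
  assumes "d \<ge> 1"
    and "M \<ge> 1"
    and "regular_expander G n d lam"
    and "v0 \<in> verts G"
  shows "(\<forall>f\<in>Lip G v0 M. \<exists>k::int.
            real (card {v \<in> verts G. f v \<notin> {k..k + int M}}) \<le> 2 * lam * real n / real d)
       \<and> (\<exists>phase :: ('a \<Rightarrow> int) \<Rightarrow> int set.
            \<forall>f\<in>Lip G v0 M. (\<exists>v\<in>verts G. f v \<noteq> 0) \<longrightarrow>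
              (\<exists>k::int. phase f = {k..k + int M} \<and>
                 real (card {v \<in> verts G. f v \<notin> {k..k + int M}}) \<le> 2 * lam * real n / real d)
              \<and> phase (\<lambda>v\<in>verts G. - f v) = uminus ` phase f)"
proof -
  define good where "good f k \<longleftrightarrow>
    real (card {v \<in> verts G. f v \<notin> {k..k + int M}}) \<le> 2 * lam * real n / real d"
    for f :: "'a \<Rightarrow> int" and k
  define neg where "neg f = (\<lambda>v\<in>verts G. - f v)" for f :: "'a \<Rightarrow> int"
  have ex_good: "\<exists>k. good f k" if "f \<in> Lip G v0 M" for f
    unfolding good_def
  proof (rule Lipschitz_concentrated[OF assms(3,1)])
    show "\<bar>f u - f v\<bar> \<le> int M" if "u \<rightarrow>\<^bsub>G\<^esub> v" for u v
      using \<open>f \<in> Lip G v0 M\<close> that by (simp add: Lip_def)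
  qed
  have good_neg: "good f (- k - int M)" if "good (neg f) k" for f k
  proof -
    have "{v \<in> verts G. f v \<notin> {- k - int M..- k - int M + int M}} =
        {v \<in> verts G. neg f v \<notin> {k..k + int M}}"
      by (auto simp: neg_def)
    then show ?thesis using that unfolding good_def by metis
  qed
  have neg_Lip: "neg f \<in> Lip G v0 M" if f: "f \<in> Lip G v0 M" for f
  proof -
    have "\<bar>neg f u - neg f v\<bar> \<le> int M" if "u \<rightarrow>\<^bsub>G\<^esub> v" for u v
    proof -
      have "wf_digraph G"
        using regular_expander_fin_digraph[OF assms(3)] by (rule fin_digraph.axioms(1))
      then have "u \<in> verts G" "v \<in> verts G"
        using that by (auto dest: wf_digraph.adj_in_verts)
      moreover have "\<bar>f u - f v\<bar> \<le> int M"
        using f that by (simp add: Lip_def)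
      ultimately show ?thesis by (simp add: neg_def)
    qed
    then show ?thesis
      using f assms(4) by (simp add: Lip_def neg_def)
  qed
  have neg_neg: "neg (neg f) = f" if "f \<in> Lip G v0 M" for f
    using that by (auto simp: neg_def Lip_def fun_eq_iff PiE_def extensional_def)

  define w where "w f = (SOME v. v \<in> verts G \<and> f v \<noteq> 0)" for f :: "'a \<Rightarrow> int"
  define base where "base f = (SOME k. good f k)" for f
  define phase where "phase f = (if f (w f) > 0 then {base f..base f + int M}
    else uminus ` {base (neg f)..base (neg f) + int M})" for f
  have good_base: "good f (base f)" if "f \<in> Lip G v0 M" for f
    unfolding base_def using ex_good[OF that] by (rule someI_ex)

  have "(\<exists>k. phase f = {k..k + int M} \<and> good f k) \<and> phase (neg f) = uminus ` phase f"
    if f: "f \<in> Lip G v0 M" and nonzero: "\<exists>v\<in>verts G. f v \<noteq> 0" for f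
  proof
    show "\<exists>k. phase f = {k..k + int M} \<and> good f k"
    proof (cases "f (w f) > 0")
      case True
      then show ?thesis using good_base[OF f] by (auto simp: phase_def)
    next
      case False
      then have "phase f = {- base (neg f) - int M..- base (neg f) - int M + int M}"
        by (simp add: phase_def)
      then show ?thesis using good_neg[OF good_base[OF neg_Lip[OF f]]] by blast
    qed
    have "w f \<in> verts G \<and> f (w f) \<noteq> 0"
      unfolding w_def using someI_ex[of "\<lambda>v. v \<in> verts G \<and> f v \<noteq> 0"] nonzero by blast
    moreover have "w (neg f) = w f"
      unfolding w_def by (rule arg_cong[where f = Eps]) (auto simp: neg_def)
    \<comment> \<open>Exactly one of \<open>f\<close> and \<open>- f\<close> is positive at the common vertex, so exactly one of the two
      phases is defined as a reflection.\<close>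
    ultimately have "neg f (w (neg f)) > 0 \<longleftrightarrow> \<not> f (w f) > 0"
      by (auto simp: neg_def)
    then show "phase (neg f) = uminus ` phase f"
      by (simp add: phase_def neg_neg[OF f])
  qed
  then show ?thesis
    using ex_good unfolding good_def neg_def by blast
qed

end
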